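(* Let $R$ be an $OAF$-ring and let $I$ be a proper ideal of $R$. Then $R/I$ is an $OAF$-ring.
   Context: All rings are commutative with nonzero identity. An ideal $I$ of a ring $R$ is proper if $I\neq R$. A proper ideal $I$ of $R$ is an $OA$-ideal ($1$-absorbing prime ideal) if whenever $a,b,c\in R$ are nonunits with $abc\in I$, then $ab\in I$ or $c\in I$. A ring is an $OAF$-ring if every proper ideal is a finite product (of at least one factor) of $OA$-ideals. *)

theory Defs
  imports "HOL-Algebra.QuotRing" "HOL-Algebra.Ideal_Product"
begin

locale OA_ideal = ideal I R + cring R for I and R (structure) +
  assumes I_notcarr: "carrier R \<noteq> I"
    and I_OA:
      "\<lbrakk>a \<in> carrier R - Units R; b \<in> carrier R - Units R; c \<in> carrier R - Units R;
        a \<otimes> b \<otimes> c \<in> I\<rbrakk> \<Longrightarrow> a \<otimes> b \<in> I \<or> c \<in> I"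

text \<open>The seed \<^term>\<open>carrier R\<close> of the fold is the neutral element of ideal multiplication.\<close>

definition ideal_list_prod :: "('a, 'm) ring_scheme \<Rightarrow> 'a set list \<Rightarrow> 'a set"
  where "ideal_list_prod R As = foldr (ideal_prod R) As (carrier R)"

locale OAF_ring = cring R for R (structure) +
  assumes one_neq_zero: "\<one> \<noteq> \<zero>"
    and OA_factorization:
      "\<lbrakk>ideal J R; carrier R \<noteq> J\<rbrakk>
        \<Longrightarrow> \<exists>As. As \<noteq> [] \<and> (\<forall>A\<in>set As. OA_ideal A R) \<and> J = ideal_list_prod R As"

end

theory Submission
  imports Defs
begin

text \<open>Let \<open>h\<close> be the projection onto the quotient. If \<open>J\<close> is a proper ideal of the quotient, its
  preimage is a proper ideal, hence a product of \<open>OA\<close>-ideals. Every factor contains this preimage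
  and therefore the kernel, so its image is again an \<open>OA\<close>-ideal: nonunits lift to nonunits, and
  membership in an ideal containing the kernel can be tested after applying \<open>h\<close>. Since \<open>h\<close> is
  surjective it commutes with products of ideals, so \<open>J\<close> is the product of the images.\<close>

text \<open>If \<open>h x = h a\<close> with \<open>a\<close> in \<open>A\<close>, then
  \<open>x \<ominus> a\<close> lies in the kernel, hence in \<open>A\<close>, and adding
  \<open>a\<close> back recovers \<open>x\<close>.\<close>

lemma (in ring_hom_ring) hom_mem_image_iff:
  assumes "ideal A R" "a_kernel R S h \<subseteq> A" "x \<in> carrier R"
  shows "h x \<in> h ` A \<longleftrightarrow> x \<in> A"
proof
  assume "h x \<in> h ` A"
  then obtain a where a: "a \<in> A" "h x = h a" by blast
  interpret A: ideal A R by fact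
  have "x \<ominus> a \<in> a_kernel R S h"
    unfolding a_kernel_def' using a assms(3) by (simp add: R.minus_eq S.r_neg)
  then have "(x \<ominus> a) \<oplus> a \<in> A"
    using assms(2) a(1) by blast
  moreover have "(x \<ominus> a) \<oplus> a = x"
    using a(1) assms(3) by (simp add: R.minus_eq R.a_assoc R.l_neg)
  ultimately show "x \<in> A" by simp
qed blast

text \<open>Surjectivity enters in the absorption law: an arbitrary multiplier from \<open>S\<close>
  has the form \<open>h x\<close>, so the product can be formed inside \<open>A\<close> before
  applying \<open>h\<close>.\<close>

lemma (in ring_hom_ring) ideal_image:
  assumes "ideal A R" and surj: "h ` carrier R = carrier S"
  shows "ideal (h ` A) S"
proof (rule idealI)
  interpret A: ideal A R by fact
  show "ring S" by (rule S.ring_axioms)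
  show "subgroup (h ` A) (add_monoid S)"
    using A.a_subgroup by (rule img_is_add_subgroup)
  fix b y assume b: "b \<in> h ` A" and y: "y \<in> carrier S"
  obtain a where a: "a \<in> A" "b = h a" using b by blast
  obtain x where x: "x \<in> carrier R" "y = h x" using y surj by blast
  have "h (x \<otimes> a) \<in> h ` A" "h (a \<otimes> x) \<in> h ` A"
    using a x A.I_l_closed A.I_r_closed by blast+
  then show "y \<otimes>\<^bsub>S\<^esub> b \<in> h ` A" "b \<otimes>\<^bsub>S\<^esub> y \<in> h ` A"
    using a x by simp_all
qed

text \<open>Both sides are generated inductively by products of elements and closed under sums. As
  \<open>h\<close> preserves both operations, each inclusion follows by induction on the
  generation.\<close>

lemma (in ring_hom_ring) image_ideal_prod:
  assumes "ideal A R" "ideal B R"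
  shows "h ` ideal_prod R A B = ideal_prod S (h ` A) (h ` B)"
proof (intro equalityI subsetI)
  interpret A: ideal A R by fact
  interpret B: ideal B R by fact
  have AB: "ideal_prod R A B \<subseteq> carrier R"
    using assms by (rule R.ideal_prod_in_carrier)
  {
    fix y assume "y \<in> h ` ideal_prod R A B"
    then obtain x where "x \<in> ideal_prod R A B" and y: "y = h x" by blast
    from this(1) have "h x \<in> ideal_prod S (h ` A) (h ` B)"
    proof induction
      case (prod i j)
      then show ?case by (simp add: ideal_prod.prod)
    next
      case (sum s1 s2)
      \<comment> \<open>Additivity of \<open>h\<close> is available only on
        \<open>carrier R\<close>, so both summands are first placed there.\<close>
      then have "s1 \<in> carrier R" "s2 \<in> carrier R" using AB by auto
      then show ?case using sum.IH by (simp add: ideal_prod.sum)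
    qed
    then show "y \<in> ideal_prod S (h ` A) (h ` B)" by (simp add: y)
  }
  fix y assume "y \<in> ideal_prod S (h ` A) (h ` B)"
  then show "y \<in> h ` ideal_prod R A B"
  proof induction
    case (prod i j)
    then obtain a b where ab: "a \<in> A" "b \<in> B" "i = h a" "j = h b" by blast
    then have "h (a \<otimes> b) \<in> h ` ideal_prod R A B"
      by (intro imageI ideal_prod.prod)
    then show ?case using ab by simp
  next
    case (sum s1 s2)
    then obtain a b where ab: "a \<in> ideal_prod R A B" "b \<in> ideal_prod R A B"
        "s1 = h a" "s2 = h b" by blast
    then have "h (a \<oplus> b) \<in> h ` ideal_prod R A B"
      by (intro imageI ideal_prod.sum)
    moreover have "a \<in> carrier R" "b \<in> carrier R" using ab AB by auto
    ultimately show ?case using ab by simp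
  qed
qed

lemma ideal_list_prod_simps [simp]:
  "ideal_list_prod R [] = carrier R"
  "ideal_list_prod R (A # As) = ideal_prod R A (ideal_list_prod R As)"
  by (simp_all add: ideal_list_prod_def)

lemma (in ring) ideal_list_prod_is_ideal:
  assumes "\<forall>A\<in>set As. ideal A R"
  shows "ideal (ideal_list_prod R As) R"
  using assms by (induction As) (simp_all add: oneideal ideal_prod_is_ideal)

text \<open>A product of two ideals lies in their intersection, so it lies in its first factor and
  in the product of the rest, where induction applies.\<close>

lemma (in ring) ideal_list_prod_subset:
  assumes "\<forall>A\<in>set As. ideal A R" and "A \<in> set As"
  shows "ideal_list_prod R As \<subseteq> A"
  using assms
proof (induction As)
  case (Cons B As)
  have "ideal_prod R B (ideal_list_prod R As) \<subseteq> B \<inter> ideal_list_prod R As"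
    using Cons.prems(1) by (intro ideal_prod_inter ideal_list_prod_is_ideal) simp_all
  then show ?case using Cons by auto
qed simp

text \<open>Surjectivity settles the empty list, where the seed \<open>carrier R\<close> has to map
  onto the seed \<open>carrier S\<close>.\<close>

lemma (in ring_hom_ring) image_ideal_list_prod:
  assumes "\<forall>A\<in>set As. ideal A R" and "h ` carrier R = carrier S"
  shows "h ` ideal_list_prod R As = ideal_list_prod S (map ((`) h) As)"
  using assms(1)
  by (induction As) (simp_all add: assms(2) image_ideal_prod R.ideal_list_prod_is_ideal)

text \<open>Used in contrapositive form: every preimage of a nonunit is a nonunit.\<close>

lemma (in ring_hom_ring) hom_Units:
  assumes "x \<in> Units R"
  shows "h x \<in> Units S"
proof -
  obtain y where y: "y \<in> carrier R" "y \<otimes> x = \<one>" "x \<otimes> y = \<one>"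
    using assms by (auto simp: Units_def)
  have "x \<in> carrier R" using assms by (rule R.Units_closed)
  then have "h y \<otimes>\<^bsub>S\<^esub> h x = \<one>\<^bsub>S\<^esub>" "h x \<otimes>\<^bsub>S\<^esub> h y = \<one>\<^bsub>S\<^esub>"
    using y by (simp_all flip: hom_mult)
  then show ?thesis
    using y(1) \<open>x \<in> carrier R\<close> by (auto simp: Units_def)
qed

lemma (in ring_hom_cring) OA_ideal_image:
  assumes "OA_ideal A R" and ker: "a_kernel R S h \<subseteq> A" and surj: "h ` carrier R = carrier S"
  shows "OA_ideal (h ` A) S"
proof -
  interpret A: OA_ideal A R by fact
  note mem_iff = ring.hom_mem_image_iff[OF A.is_ideal ker]
  have nonunit_lift: "\<exists>x \<in> carrier R - Units R. y = h x" if "y \<in> carrier S - Units S" for y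
  proof -
    have "y \<in> h ` carrier R" using that surj by simp
    then obtain x where "x \<in> carrier R" "y = h x" by blast
    then show ?thesis using that ring.hom_Units by blast
  qed
  show ?thesis
  proof (intro OA_ideal.intro OA_ideal_axioms.intro)
    show "ideal (h ` A) S"
      using A.is_ideal surj by (rule ring.ideal_image)
    show "cring S" by (rule S.is_cring)
    show "carrier S \<noteq> h ` A"
    proof
      assume "carrier S = h ` A"
      then have "h \<one> \<in> h ` A" using S.one_closed by simp
      then have "\<one> \<in> A" using mem_iff by blast
      then show False using A.one_imp_carrier A.I_notcarr by blast
    qed
  next
    fix a b c
    assume "a \<in> carrier S - Units S" "b \<in> carrier S - Units S" "c \<in> carrier S - Units S"
      and abc: "a \<otimes>\<^bsub>S\<^esub> b \<otimes>\<^bsub>S\<^esub> c \<in> h ` A"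
    then obtain x y z where nonunits: "x \<in> carrier R - Units R" "y \<in> carrier R - Units R"
        "z \<in> carrier R - Units R" and hxyz: "a = h x" "b = h y" "c = h z"
      using nonunit_lift by meson
    have carr: "x \<in> carrier R" "y \<in> carrier R" "z \<in> carrier R"
      using nonunits by auto
    have "h (x \<otimes> y \<otimes> z) \<in> h ` A"
      using abc hxyz carr by simp
    then have "x \<otimes> y \<otimes> z \<in> A"
      using mem_iff[of "x \<otimes> y \<otimes> z"] carr by simp
    then have "x \<otimes> y \<in> A \<or> z \<in> A"
      using A.I_OA nonunits by blast
    then have "h (x \<otimes> y) \<in> h ` A \<or> h z \<in> h ` A" by blast
    then show "a \<otimes>\<^bsub>S\<^esub> b \<in> h ` A \<or> c \<in> h ` A"
      using hxyz carr by simp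
  qed
qed

lemma (in ring_hom_cring) OAF_ring_image:
  assumes "OAF_ring R" and surj: "h ` carrier R = carrier S" and "\<one>\<^bsub>S\<^esub> \<noteq> \<zero>\<^bsub>S\<^esub>"
  shows "OAF_ring S"
proof (intro OAF_ring.intro OAF_ring_axioms.intro)
  show "cring S" by (rule S.is_cring)
  show "\<one>\<^bsub>S\<^esub> \<noteq> \<zero>\<^bsub>S\<^esub>" by fact
  fix J assume J: "ideal J S" "carrier S \<noteq> J"
  interpret J: ideal J S by fact
  define P where "P = {r \<in> carrier R. h r \<in> J}"
  have "ideal P R"
    unfolding P_def using J(1) by (rule ring.ideal_vimage)
  moreover have "carrier R \<noteq> P"
  proof
    assume "carrier R = P"
    then have "h \<one> \<in> J" unfolding P_def by blast
    then show False using J(2) J.one_imp_carrier by simp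
  qed
  ultimately obtain As where As: "As \<noteq> []" "\<forall>A\<in>set As. OA_ideal A R"
      "P = ideal_list_prod R As"
    using OAF_ring.OA_factorization[OF assms(1)] by blast
  have ideals: "\<forall>A\<in>set As. ideal A R"
    using As(2) by (auto simp: OA_ideal_def)
  \<comment> \<open>An element of the kernel is sent to zero, which belongs to
    \<open>J\<close>.\<close>
  have "a_kernel R S h \<subseteq> P"
    unfolding P_def a_kernel_def' using J.zero_closed by force
  then have "a_kernel R S h \<subseteq> A" if "A \<in> set As" for A
    using R.ideal_list_prod_subset[OF ideals that] As(3) by blast
  then have "\<forall>B\<in>set (map ((`) h) As). OA_ideal B S"
    using OA_ideal_image surj As(2) by simp
  \<comment> \<open>Surjectivity gives every element of \<open>J\<close> a preimage, which lies in
    \<open>P\<close> by definition.\<close>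
  moreover have "J = h ` P"
  proof
    show "J \<subseteq> h ` P"
    proof
      fix y assume "y \<in> J"
      moreover from this have "y \<in> h ` carrier R" using J.a_subset surj by auto
      ultimately show "y \<in> h ` P" unfolding P_def by auto
    qed
  qed (auto simp: P_def)
  then have "J = ideal_list_prod S (map ((`) h) As)"
    using ring.image_ideal_list_prod[OF ideals surj] As(3) by simp
  ultimately show "\<exists>Bs. Bs \<noteq> [] \<and> (\<forall>B\<in>set Bs. OA_ideal B S) \<and> J = ideal_list_prod S Bs"
    using As(1) by (intro exI[of _ "map ((`) h) As"]) simp
qed

theorem proposition2p2:
  fixes R :: "('a, 'm) ring_scheme" and I :: "'a set"
  assumes "OAF_ring R"
    and "ideal I R"
    and "carrier R \<noteq> I"
  shows "OAF_ring (R Quot I)"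
proof -
  interpret OAF_ring R by fact
  interpret I: ideal I R by fact
  \<comment> \<open>The coset of \<open>\<one>\<close> contains \<open>\<one>\<close>, so if it were
    \<open>I\<close>, the zero of the quotient, then \<open>I\<close> would contain
    \<open>\<one>\<close> and be the whole ring.\<close>
  have "I +>\<^bsub>R\<^esub> \<one>\<^bsub>R\<^esub> \<noteq> I"
    using I.a_rcos_self[OF one_closed] I.one_imp_carrier assms(3) by metis
  then have one_neq: "\<one>\<^bsub>R Quot I\<^esub> \<noteq> \<zero>\<^bsub>R Quot I\<^esub>"
    by (simp add: FactRing_def)
  interpret proj: ring_hom_cring R "R Quot I" "(+>\<^bsub>R\<^esub>) I"
    by (rule I.rcos_ring_hom_cring[OF is_cring])
  show ?thesis
  proof (rule proj.OAF_ring_image)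
    show "OAF_ring R" by fact
    show "(+>\<^bsub>R\<^esub>) I ` carrier R = carrier (R Quot I)"
      unfolding FactRing_def A_RCOSETS_def' by auto
    show "\<one>\<^bsub>R Quot I\<^esub> \<noteq> \<zero>\<^bsub>R Quot I\<^esub>"
      by (rule one_neq)
  qed
qed

end
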